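(* Let $M$ be an $n\times n$ complex matrix with spectral radius $\rho(M)<1$, and let $S$ be the set of dominant eigenvalues of $M$, i.e. the set of eigenvalues $\lambda$ of $M$ with $|\lambda|=\rho(M)$. Suppose that $|S|\geq 2$. Let $\mathbf{g}\in\mathbb{C}^n$, and for each positive integer $k$ consider the iterative process $$\mathbf{x}^{(m)}=M^{k}\mathbf{x}^{(m-1)}+\mathbf{h},\qquad \mathbf{h}=(I+M+\cdots+M^{k-1})\mathbf{g}. \qquad (\ast_k)$$ There are two cases: (1) If $\lambda_1/\lambda_2$ is a root of unity for each pair of eigenvalues $\lambda_1$ and $\lambda_2$ in $S$, then there exists a positive integer $k$ such that the generalized Chebyshev acceleration is applicable to $(\ast_k)$. (2) If there are two eigenvalues $\lambda_1$ and $\lambda_2$ in $S$ such that $\zeta=\lambda_1/\lambda_2$ is not a root of unity, then for no positive integer $k$ is the generalized Chebyshev acceleration applicable to $(\ast_k)$.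
   Context: Define, for $\theta=(\theta_1,\theta_2)\in\mathbb{R}^2$, $$\varphi_1(\theta)=\tfrac13\left(e^{2\pi i\theta_1}+e^{-2\pi i\theta_2}+e^{2\pi i(\theta_2-\theta_1)}\right),$$ and let $\Delta=\{\varphi_1(\theta):\theta\in\mathbb{R}^2\}\subset\mathbb{C}$. This is the closed region enclosed by the Steiner hypocycloid (deltoid) $z=(2e^{it}+e^{-2it})/3$, $t\in\mathbb{R}$, with corners at the third roots of unity. A complex number $z$ is a root of unity if $z^n=1$ for some positive integer $n$. The set $S$ is a set of distinct eigenvalues (without multiplicity). Applicability: the generalized Chebyshev acceleration (the semi-iterative method associated with the root system $A_2$) is said to be applicable to an iterative process $\mathbf{x}^{(m)}=N\mathbf{x}^{(m-1)}+\mathbf{h}$, where $N$ is a square complex matrix with $\rho(N)<1$, if $N$ has a nonzero eigenvalue $\mu_1$ with $|\mu_1|=\rho(N)$ such that $\mu/\mu_1\in\Delta$ for every eigenvalue $\mu$ of $N$. *)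

theory Defs
  imports "Jordan_Normal_Form.Spectral_Radius"
begin

definition phi1 :: "real \<times> real \<Rightarrow> complex" where
  "phi1 \<theta> = (1/3) * (exp (2 * of_real pi * \<i> * of_real (fst \<theta>))
     + exp (- (2 * of_real pi * \<i> * of_real (snd \<theta>)))
     + exp (2 * of_real pi * \<i> * of_real (snd \<theta> - fst \<theta>)))"

definition Delta :: "complex set" where
  "Delta = range phi1"

definition root_of_unity :: "complex \<Rightarrow> bool" where
  "root_of_unity z \<longleftrightarrow> (\<exists>n::nat. 0 < n \<and> z ^ n = 1)"

definition dominant_eigenvalues :: "complex mat \<Rightarrow> complex set" where
  "dominant_eigenvalues M = {\<mu>. eigenvalue M \<mu> \<and> cmod \<mu> = spectral_radius M}"

(* The pair (N, h) stands for the iterative process x_m = N x_(m-1) + h. *)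
type_synonym iterative_process = "complex mat \<times> complex vec"

(* The first three conjuncts describe the iterative processes under consideration
   (N square of the same dimension as h, with spectral radius below 1); the last one
   is the condition on N, which does not involve h. *)
definition chebyshev_applicable :: "iterative_process \<Rightarrow> bool" where
  "chebyshev_applicable P \<longleftrightarrow> (case P of (N, h) \<Rightarrow>
     square_mat N \<and> h \<in> carrier_vec (dim_row N) \<and> spectral_radius N < 1 \<and>
     (\<exists>\<mu>1. eigenvalue N \<mu>1 \<and> \<mu>1 \<noteq> 0 \<and> cmod \<mu>1 = spectral_radius N \<and>
        (\<forall>\<mu>. eigenvalue N \<mu> \<longrightarrow> \<mu> / \<mu>1 \<in> Delta)))"

(* I + M + ... + M^(k-1), summed entrywise because the type of matrices of arbitrary
   dimension has no zero and hence no library sum operator. *)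
definition geometric_sum_mat :: "complex mat \<Rightarrow> nat \<Rightarrow> complex mat" where
  "geometric_sum_mat M k =
     mat (dim_row M) (dim_col M) (\<lambda>ij. \<Sum>l<k. (M ^\<^sub>m l) $$ ij)"

definition power_process :: "complex mat \<Rightarrow> complex vec \<Rightarrow> nat \<Rightarrow> iterative_process" where
  "power_process M g k = (M ^\<^sub>m k, geometric_sum_mat M k *\<^sub>v g)"

end

theory Submission
  imports Defs
begin

text \<open>
  The eigenvalues of \<open>M ^ k\<close> are the \<open>k\<close>-th powers of those of \<open>M\<close>, so everything is
  decided by which quotients \<open>(\<mu> / \<lambda>) ^ k\<close> lie in the deltoid, where \<open>\<lambda>\<close> is dominant.  Two facts
  about the deltoid suffice: it meets the unit circle only in the cube roots of unity
  (\<open>Delta_unit_circle\<close>), and it contains the closed disc of radius \<open>1/3\<close> around the origin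
  (\<open>cball_subset_Delta\<close>).

  If all quotients of dominant eigenvalues are roots of unity, a common exponent \<open>K\<close> makes all
  dominant eigenvalues of \<open>M ^ K\<close> coincide.  The quotient of two dominant eigenvalues is then
  \<open>1\<close>, a corner of the deltoid, and raising to a further high power pushes the quotients
  belonging to the remaining eigenvalues into the small disc.

  Conversely, if the acceleration is applicable to the \<open>k\<close>-th process, with distinguished
  eigenvalue \<open>\<nu>\<close>, then \<open>\<lambda> ^ k / \<nu>\<close> is a point of the deltoid of modulus \<open>1\<close>, hence a cube root of
  unity, for every dominant \<open>\<lambda>\<close>.  Therefore \<open>(\<lambda>\<^sub>1 / \<lambda>\<^sub>2) ^ (3 k) = 1\<close> for all dominant
  \<open>\<lambda>\<^sub>1\<close> and \<open>\<lambda>\<^sub>2\<close>.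
\<close>

section \<open>The deltoid\<close>

text \<open>
  The parametrization by two angles says that the deltoid consists of the normalized traces of
  the special unitary \<open>3 \<times> 3\<close> matrices; this form is symmetric in the three eigenvalues and free of
  angles.
\<close>

lemma Delta_iff:
  "z \<in> Delta \<longleftrightarrow> (\<exists>u v w. cmod u = 1 \<and> cmod v = 1 \<and> cmod w = 1 \<and> u * v * w = 1 \<and>
     z = (u + v + w) / 3)"
proof
  have phi1_cis: "phi1 (a, b) = (cis (2 * pi * a) + cis (- (2 * pi * b)) + cis (2 * pi * (b - a))) / 3"
    for a b
    by (simp add: phi1_def cis_conv_exp mult_ac)
  {
    assume "z \<in> Delta"
    then obtain a b where z: "z = phi1 (a, b)"
      by (auto simp: Delta_def)
    have "cis (2 * pi * a) * cis (- (2 * pi * b)) * cis (2 * pi * (b - a)) = 1"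
      by (simp add: cis_mult algebra_simps)
    then show "\<exists>u v w. cmod u = 1 \<and> cmod v = 1 \<and> cmod w = 1 \<and> u * v * w = 1 \<and>
       z = (u + v + w) / 3"
      unfolding z phi1_cis using norm_cis by blast
  }
  assume "\<exists>u v w. cmod u = 1 \<and> cmod v = 1 \<and> cmod w = 1 \<and> u * v * w = 1 \<and>
     z = (u + v + w) / 3"
  then obtain u v w where uvw: "cmod u = 1" "cmod v = 1" "u * v * w = 1"
    and z: "z = (u + v + w) / 3"
    by blast
  define a b where "a = Arg u / (2 * pi)" and "b = - (Arg v / (2 * pi))"
  have cis_Arg_unit: "cis (Arg x) = x" if "cmod x = 1" for x
    using that cis_Arg[of x] by (cases "x = 0") (auto simp: sgn_eq)
  have u: "u = cis (2 * pi * a)"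
    using cis_Arg_unit[OF uvw(1)] by (simp add: a_def)
  have v: "v = cis (- (2 * pi * b))"
    using cis_Arg_unit[OF uvw(2)] by (simp add: b_def)
  have "w = inverse (u * v)"
    using uvw(3) by (metis inverse_unique)
  also have "\<dots> = cis (2 * pi * (b - a))"
    unfolding u v cis_mult cis_inverse by (simp add: algebra_simps)
  finally have "z = phi1 (a, b)"
    unfolding z phi1_cis u v by simp
  then show "z \<in> Delta"
    by (auto simp: Delta_def)
qed

lemma one_in_Delta: "1 \<in> Delta"
proof -
  have "(1::complex) = (1 + 1 + 1) / 3"
    by simp
  then show ?thesis
    unfolding Delta_iff by (metis mult_1 norm_one)
qed

text \<open>
  The mean of three points of the unit circle can only have modulus \<open>1\<close> if the three points
  agree; since their product is \<open>1\<close>, their common value is a cube root of unity.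
\<close>

lemma Delta_unit_circle:
  assumes "z \<in> Delta" "cmod z = 1"
  shows "z ^ 3 = 1"
proof -
  obtain u v w where uvw: "cmod u = 1" "cmod v = 1" "cmod w = 1" "u * v * w = 1"
    and z: "z = (u + v + w) / 3"
    using assms(1) unfolding Delta_iff by blast
  have z0: "z \<noteq> 0"
    using assms(2) by auto
  have eq1: "a = 1" if "cmod a = 1" "Re a \<ge> 1" for a
  proof -
    have "Re a = 1"
      using complex_Re_le_cmod[of a] that by simp
    moreover have "(Re a)\<^sup>2 + (Im a)\<^sup>2 = 1"
      using that(1) cmod_power2[of a] by simp
    ultimately show ?thesis
      by (simp add: complex_eq_iff)
  qed
  have nrm: "cmod (u / z) = 1" "cmod (v / z) = 1" "cmod (w / z) = 1"
    using uvw assms(2) by (simp_all add: norm_divide)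
  have "u / z + v / z + w / z = 3"
    using z z0 by (simp add: field_simps)
  then have "Re (u / z) + Re (v / z) + Re (w / z) = 3"
    by (metis plus_complex.sel(1) complex_Re_numeral)
  then have "Re (u / z) \<ge> 1" "Re (v / z) \<ge> 1" "Re (w / z) \<ge> 1"
    using complex_Re_le_cmod[of "u / z"] complex_Re_le_cmod[of "v / z"]
      complex_Re_le_cmod[of "w / z"] nrm by linarith+
  then have "u / z = 1" "v / z = 1" "w / z = 1"
    using eq1 nrm by blast+
  then have "u = z" "v = z" "w = z"
    using z0 by simp_all
  then show ?thesis
    using uvw(4) by (simp add: power3_eq_cube)
qed

text \<open>
  For a fixed first point \<open>cis (2 t)\<close>, the other two are \<open>cis (- t \<plusminus> s)\<close>, and their sum
  \<open>2 cos s cis (- t)\<close> sweeps out the segment of length \<open>4\<close> centred at the origin in direction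
  \<open>cis (- t)\<close>.  So \<open>z\<close> lies in the deltoid as soon as \<open>(3 z - cis (2 t)) cis t\<close> is real and of
  modulus at most \<open>2\<close>.  For \<open>\<bar>z\<bar> \<le> 1/3\<close> the bound is clear, and its imaginary part
  \<open>Im (3 z cis t) - sin (3 t)\<close> changes sign between \<open>- pi/6\<close> and \<open>pi/6\<close>.
\<close>

lemma cball_subset_Delta:
  assumes "cmod z \<le> 1/3"
  shows "z \<in> Delta"
proof -
  define f where "f t = Im ((3 * z - cis (2 * t)) * cis t)" for t
  have f_eq: "f t = Im (3 * z * cis t) - sin (3 * t)" for t
    by (simp add: f_def left_diff_distrib cis_mult)
  have bound: "\<bar>Im (3 * z * cis t)\<bar> \<le> 1" for t
    using abs_Im_le_cmod[of "3 * z * cis t"] assms by (simp add: norm_mult)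
  have "f (pi/6) \<le> 0"
    using bound[of "pi/6"] by (simp add: f_eq)
  moreover have "0 \<le> f (- (pi/6))"
    using bound[of "- (pi/6)"] by (simp add: f_eq)
  moreover have "continuous_on {- (pi/6)..pi/6} f"
    unfolding f_def cis_conv_exp by (intro continuous_intros)
  ultimately obtain t where t: "f t = 0"
    using IVT2'[of f "pi/6" 0 "- (pi/6)"] by auto
  define c where "c = Re ((3 * z - cis (2 * t)) * cis t) / 2"
  have c: "(3 * z - cis (2 * t)) * cis t = of_real (2 * c)"
    using t by (simp add: c_def f_def complex_eq_iff)
  have "cmod ((3 * z - cis (2 * t)) * cis t) \<le> 2"
    using norm_triangle_ineq4[of "3 * z" "cis (2 * t)"] assms by (simp add: norm_mult)
  then have "\<bar>c\<bar> \<le> 1"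
    unfolding c by (simp add: norm_mult)
  then have cos: "cos (arccos c) = c"
    by (simp add: abs_le_iff)
  define s where "s = arccos c"
  have "cis (- t + s) + cis (- t - s) = of_real (2 * c) * cis (- t)"
    using cos by (simp add: complex_eq_iff s_def cos_add sin_add cos_diff sin_diff)
  also have "\<dots> = 3 * z - cis (2 * t)"
    unfolding c[symmetric] mult.assoc cis_mult by simp
  finally have "z = (cis (2 * t) + cis (- t + s) + cis (- t - s)) / 3"
    by (simp add: field_simps)
  moreover have "cis (2 * t) * cis (- t + s) * cis (- t - s) = 1"
    by (simp add: cis_mult)
  ultimately show ?thesis
    unfolding Delta_iff using norm_cis by blast
qed

section \<open>Eigenvalues of matrix powers\<close>

lemma upper_triangular_pow:
  fixes B :: "'a :: comm_ring_1 mat"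
  assumes B: "B \<in> carrier_mat n n" and ut: "upper_triangular B"
  shows "upper_triangular (B ^\<^sub>m k) \<and> (\<forall>i<n. (B ^\<^sub>m k) $$ (i, i) = (B $$ (i, i)) ^ k)"
proof (induction k)
  case 0
  show ?case
    using B by (auto simp: upper_triangular_def)
next
  case (Suc k)
  have C: "B ^\<^sub>m k \<in> carrier_mat n n"
    using B by simp
  have zero: "(B ^\<^sub>m k) $$ (i, l) * B $$ (l, j) = 0"
    if "i < n" "l < n" "l < i \<or> j < l" for i j l
    using that Suc.IH ut B C unfolding upper_triangular_def by auto
  have entry: "(B ^\<^sub>m Suc k) $$ (i, j) = (\<Sum>l = 0..<n. (B ^\<^sub>m k) $$ (i, l) * B $$ (l, j))"
    if "i < n" "j < n" for i j
    using that B C by (simp add: scalar_prod_def)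
  have "(B ^\<^sub>m Suc k) $$ (i, i) = (B $$ (i, i)) ^ Suc k" if i: "i < n" for i
  proof -
    have "(B ^\<^sub>m Suc k) $$ (i, i) = (\<Sum>l\<in>{i}. (B ^\<^sub>m k) $$ (i, l) * B $$ (l, i))"
      unfolding entry[OF i i] using i by (intro sum.mono_neutral_right) (auto intro!: zero)
    then show ?thesis
      using Suc.IH i by (simp add: mult.commute)
  qed
  moreover have "(B ^\<^sub>m Suc k) $$ (i, j) = 0" if "i < n" "j < i" for i j
    unfolding entry[OF that(1) less_trans[OF that(2,1)]]
    using that by (intro sum.neutral ballI zero) auto
  ultimately show ?case
    using B C unfolding upper_triangular_def by auto
qed

lemma eigenvalue_upper_triangular:
  fixes A :: "'a :: field mat"
  assumes "A \<in> carrier_mat n n" "upper_triangular A"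
  shows "eigenvalue A x \<longleftrightarrow> (\<exists>i<n. x = A $$ (i, i))"
proof -
  have "eigenvalue A x \<longleftrightarrow> x \<in> set (diag_mat A)"
    unfolding eigenvalue_root_char_poly[OF assms(1)] char_poly_upper_triangular[OF assms]
    by (auto simp: poly_prod_list prod_list_zero_iff)
  also have "\<dots> \<longleftrightarrow> (\<exists>i<n. x = A $$ (i, i))"
    using assms(1) by (auto simp: diag_mat_def)
  finally show ?thesis .
qed

text \<open>
  A Schur triangularization \<open>B\<close> of \<open>M\<close> also triangularizes the power, because similarity is
  compatible with powers, and the eigenvalues of a triangular matrix stand on its diagonal.
\<close>

lemma eigenvalue_pow_iff:
  fixes M :: "complex mat"
  assumes M: "M \<in> carrier_mat n n"
  shows "eigenvalue (M ^\<^sub>m k) x \<longleftrightarrow> (\<exists>y. eigenvalue M y \<and> x = y ^ k)"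
proof -
  obtain B where B: "B \<in> carrier_mat n n" "upper_triangular B" and sim: "similar_mat M B"
    using char_poly_factorized[OF M] schur_decomposition_exists[OF M] by blast
  obtain P Q where "similar_mat_wit M B P Q"
    using sim unfolding similar_mat_def by blast
  then have sim_pow: "similar_mat (M ^\<^sub>m k) (B ^\<^sub>m k)"
    unfolding similar_mat_def using similar_mat_wit_pow by blast
  have Bk: "B ^\<^sub>m k \<in> carrier_mat n n" and Mk: "M ^\<^sub>m k \<in> carrier_mat n n"
    using B M by simp_all
  have "eigenvalue (M ^\<^sub>m k) x \<longleftrightarrow> eigenvalue (B ^\<^sub>m k) x"
    unfolding eigenvalue_root_char_poly[OF Mk] eigenvalue_root_char_poly[OF Bk]
      char_poly_similar[OF sim_pow] ..
  also have "\<dots> \<longleftrightarrow> (\<exists>i<n. x = (B $$ (i, i)) ^ k)"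
    using eigenvalue_upper_triangular[OF Bk] upper_triangular_pow[OF B] by auto
  also have "\<dots> \<longleftrightarrow> (\<exists>y. eigenvalue B y \<and> x = y ^ k)"
    using eigenvalue_upper_triangular[OF B] by auto
  also have "\<dots> \<longleftrightarrow> (\<exists>y. eigenvalue M y \<and> x = y ^ k)"
    unfolding eigenvalue_root_char_poly[OF M] eigenvalue_root_char_poly[OF B(1)]
      char_poly_similar[OF sim] ..
  finally show ?thesis .
qed

lemma cmod_eigenvalue_le_spectral_radius:
  assumes "M \<in> carrier_mat n n" "eigenvalue M x"
  shows "cmod x \<le> spectral_radius M"
  using spectral_radius_mem_max(2)[OF assms(1) eigenvalue_imp_nonzero_dim[OF assms]] assms(2)
  by (auto simp: spectrum_def)

lemma spectral_radius_pow:
  assumes M: "M \<in> carrier_mat n n" and n: "n > 0"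
  shows "spectral_radius (M ^\<^sub>m k) = spectral_radius M ^ k"
proof (rule antisym)
  have Mk: "M ^\<^sub>m k \<in> carrier_mat n n"
    using M by simp
  obtain x where x: "eigenvalue (M ^\<^sub>m k) x" "cmod x = spectral_radius (M ^\<^sub>m k)"
    using spectral_radius_mem_max(1)[OF Mk n] by (auto simp: spectrum_def)
  obtain y where "eigenvalue M y" "x = y ^ k"
    using x(1) unfolding eigenvalue_pow_iff[OF M] by blast
  then show "spectral_radius (M ^\<^sub>m k) \<le> spectral_radius M ^ k"
    using cmod_eigenvalue_le_spectral_radius[OF M] x(2)
    by (metis norm_power norm_ge_zero power_mono)
  obtain z where z: "eigenvalue M z" "cmod z = spectral_radius M"
    using spectral_radius_mem_max(1)[OF M n] by (auto simp: spectrum_def)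
  then have "eigenvalue (M ^\<^sub>m k) (z ^ k)"
    unfolding eigenvalue_pow_iff[OF M] by blast
  then show "spectral_radius M ^ k \<le> spectral_radius (M ^\<^sub>m k)"
    using cmod_eigenvalue_le_spectral_radius[OF Mk] z(2) by (metis norm_power)
qed

section \<open>Applicability of the acceleration\<close>

text \<open>
  Since the spectral radius of \<open>M ^ k\<close> is the \<open>k\<close>-th power of that of \<open>M\<close>, an eigenvalue \<open>x ^ k\<close> of
  the power is dominant exactly if \<open>x\<close> is.  This turns applicability into a condition on the
  spectrum of \<open>M\<close> alone.
\<close>

lemma chebyshev_applicable_power_process_iff:
  assumes M: "M \<in> carrier_mat n n" and n: "n > 0" and k: "k > 0"
    and \<rho>: "0 < spectral_radius M" "spectral_radius M < 1"
  shows "chebyshev_applicable (power_process M g k) \<longleftrightarrow>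
    (\<exists>x \<in> dominant_eigenvalues M. \<forall>y. eigenvalue M y \<longrightarrow> (y / x) ^ k \<in> Delta)"
proof -
  have "square_mat (M ^\<^sub>m k)" "geometric_sum_mat M k *\<^sub>v g \<in> carrier_vec (dim_row (M ^\<^sub>m k))"
    using M by (auto simp: geometric_sum_mat_def mult_mat_vec_def)
  moreover have "spectral_radius M ^ k < 1"
    using \<rho> k by (simp add: power_Suc_less_one power_less_one_iff)
  ultimately have "chebyshev_applicable (power_process M g k) \<longleftrightarrow>
    (\<exists>m. (\<exists>x. eigenvalue M x \<and> m = x ^ k) \<and> m \<noteq> 0 \<and> cmod m = spectral_radius M ^ k \<and>
       (\<forall>\<mu>. (\<exists>y. eigenvalue M y \<and> \<mu> = y ^ k) \<longrightarrow> \<mu> / m \<in> Delta))"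
    unfolding chebyshev_applicable_def power_process_def prod.case spectral_radius_pow[OF M n]
      eigenvalue_pow_iff[OF M] by blast
  also have "\<dots> \<longleftrightarrow> (\<exists>x. eigenvalue M x \<and> x ^ k \<noteq> 0 \<and> cmod (x ^ k) = spectral_radius M ^ k \<and>
       (\<forall>y. eigenvalue M y \<longrightarrow> y ^ k / x ^ k \<in> Delta))"
    by blast
  finally have "chebyshev_applicable (power_process M g k) \<longleftrightarrow>
    (\<exists>x. eigenvalue M x \<and> x ^ k \<noteq> 0 \<and> cmod x ^ k = spectral_radius M ^ k \<and>
       (\<forall>y. eigenvalue M y \<longrightarrow> (y / x) ^ k \<in> Delta))"
    by (simp only: norm_power power_divide)
  moreover have "x ^ k \<noteq> 0 \<and> cmod x ^ k = spectral_radius M ^ k \<longleftrightarrow> cmod x = spectral_radius M" for x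
    using \<rho>(1) k by (auto simp: power_eq_iff_eq_base)
  ultimately show ?thesis
    unfolding dominant_eigenvalues_def by auto
qed

theorem theorem2:
  fixes M :: "complex mat" and g :: "complex vec" and n :: nat
  assumes "M \<in> carrier_mat n n"
    and "spectral_radius M < 1"
    and "card (dominant_eigenvalues M) \<ge> 2"
    and "g \<in> carrier_vec n"
  shows "((\<forall>\<mu>1 \<in> dominant_eigenvalues M. \<forall>\<mu>2 \<in> dominant_eigenvalues M. root_of_unity (\<mu>1 / \<mu>2))
            \<longrightarrow> (\<exists>k::nat. 0 < k \<and> chebyshev_applicable (power_process M g k))) \<and>
         ((\<exists>\<mu>1 \<in> dominant_eigenvalues M. \<exists>\<mu>2 \<in> dominant_eigenvalues M. \<not> root_of_unity (\<mu>1 / \<mu>2))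
            \<longrightarrow> \<not> (\<exists>k::nat. 0 < k \<and> chebyshev_applicable (power_process M g k)))"
proof -
  define S where "S = dominant_eigenvalues M"
  define \<rho> where "\<rho> = spectral_radius M"
  have S: "x \<in> S \<longleftrightarrow> eigenvalue M x \<and> cmod x = \<rho>" for x
    by (simp add: S_def dominant_eigenvalues_def \<rho>_def)
  have fin: "finite {x. eigenvalue M x}"
    using card_finite_spectrum(1)[OF assms(1)] by (simp add: spectrum_def)
  have finS: "finite S"
    by (rule finite_subset[OF _ fin]) (auto simp: S)
  obtain l where l: "l \<in> S"
    using assms(3) unfolding S_def by fastforce
  have n: "n > 0"
    using l eigenvalue_imp_nonzero_dim[OF assms(1)] by (auto simp: S)
  \<comment> \<open>Two distinct eigenvalues of the same modulus cannot both vanish.\<close>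
  have "\<rho> \<noteq> 0"
  proof
    assume "\<rho> = 0"
    then have "S \<subseteq> {0}"
      by (auto simp: S)
    then have "card S \<le> 1"
      using card_mono[of "{0}" S] by simp
    with assms(3) show False
      by (simp add: S_def)
  qed
  with l have \<rho>: "\<rho> > 0"
    by (auto simp: S)
  have nz: "x \<noteq> 0" if "x \<in> S" for x
    using that \<rho> by (auto simp: S)
  note applicable = chebyshev_applicable_power_process_iff[OF assms(1) n _
    \<rho>[unfolded \<rho>_def] assms(2), of _ g, folded S_def]
  show ?thesis
    unfolding S_def[symmetric]
  proof (intro conjI impI)
    assume "\<forall>x\<in>S. \<forall>y\<in>S. root_of_unity (x / y)"
    then have "\<forall>x\<in>S. \<exists>m>0. (x / l) ^ m = 1"
      using l by (auto simp: root_of_unity_def)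
    then obtain m where m: "m x > 0" "(x / l) ^ m x = 1" if "x \<in> S" for x
      by metis
    define K where "K = (\<Prod>x\<in>S. m x)"
    have K: "K > 0"
      unfolding K_def by (intro prod_pos) (use m in auto)
    have unity: "(x / l) ^ (K * j) = 1" if "x \<in> S" for x j
    proof -
      have "m x dvd K * j"
        unfolding K_def using finS that by (simp add: dvd_prodI)
      then obtain i where i: "K * j = m x * i" ..
      show ?thesis
        unfolding i power_mult m(2)[OF that] by simp
    qed
    have "\<forall>x\<in>{x. eigenvalue M x} - S. \<forall>\<^sub>F j in sequentially. cmod (x / l) ^ j < 1/3"
    proof
      fix x
      assume x: "x \<in> {x. eigenvalue M x} - S"
      then have "cmod x < \<rho>"
        using cmod_eigenvalue_le_spectral_radius[OF assms(1), of x] by (auto simp: S \<rho>_def)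
      then have "cmod (x / l) < 1"
        using l \<rho> by (simp add: S norm_divide)
      then have "(\<lambda>j. cmod (x / l) ^ j) \<longlonglongrightarrow> 0"
        by (intro LIMSEQ_realpow_zero) auto
      then show "\<forall>\<^sub>F j in sequentially. cmod (x / l) ^ j < 1/3"
        by (rule order_tendstoD) simp
    qed
    then have "\<forall>\<^sub>F j in sequentially. \<forall>x\<in>{x. eigenvalue M x} - S. cmod (x / l) ^ j < 1/3"
      using fin by (intro eventually_ball_finite) auto
    then obtain N where small: "cmod (x / l) ^ j < 1/3"
      if "eigenvalue M x" "x \<notin> S" "j \<ge> N" for x j
      unfolding eventually_sequentially by blast
    \<comment> \<open>A multiple of \<open>K\<close> for the dominant eigenvalues that is at least \<open>N\<close> for the others.\<close>
    define k where "k = K * Suc N"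
    have "1 * N \<le> k"
      unfolding k_def using K by (intro mult_le_mono) auto
    then have "N \<le> k"
      by simp
    have "(x / l) ^ k \<in> Delta" if x: "eigenvalue M x" for x
    proof (cases "x \<in> S")
      case True
      then have "(x / l) ^ k = 1"
        unfolding k_def by (rule unity)
      then show ?thesis
        using one_in_Delta by simp
    next
      case False
      then show ?thesis
        using small[OF x _ \<open>N \<le> k\<close>] by (intro cball_subset_Delta) (simp add: norm_power)
    qed
    moreover have "k > 0"
      using K by (simp add: k_def)
    ultimately show "\<exists>k. 0 < k \<and> chebyshev_applicable (power_process M g k)"
      using applicable l by blast
  next
    assume "\<exists>x\<in>S. \<exists>y\<in>S. \<not> root_of_unity (x / y)"
    then obtain x y where xy: "x \<in> S" "y \<in> S" "\<not> root_of_unity (x / y)"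
      by blast
    show "\<not> (\<exists>k. 0 < k \<and> chebyshev_applicable (power_process M g k))"
    proof
      assume "\<exists>k. 0 < k \<and> chebyshev_applicable (power_process M g k)"
      then obtain k d where k: "k > 0" and d: "d \<in> S"
        and Delta: "\<And>z. eigenvalue M z \<Longrightarrow> (z / d) ^ k \<in> Delta"
        using applicable by blast
      have cube: "(z / d) ^ (k * 3) = 1" if "z \<in> S" for z
      proof -
        have "cmod ((z / d) ^ k) = 1"
          using that d \<rho> by (simp add: S norm_power norm_divide)
        then show ?thesis
          using Delta_unit_circle Delta that unfolding S power_mult by blast
      qed
      have "x / y = (x / d) / (y / d)"
        using nz[OF d] by simp
      then have "(x / y) ^ (k * 3) = 1"
        using cube xy(1,2) by (simp only: power_divide[of "x / d"]) simp
      then have "root_of_unity (x / y)"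
        using k unfolding root_of_unity_def by (intro exI[of _ "k * 3"]) simp
      with xy(3) show False ..
    qed
  qed
qed

end
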